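(* Let $K$ be an abelian group and let $Q$, $F$ be loops. The following conditions are equivalent: (i) $Q$ is an extension of $K$ by $F$ and $K\le N(Q)$ (that is, up to identifying $K$ with a subloop of $Q$: $K\unlhd Q$, $Q/K\cong F$, and $K\le N(Q)$); (ii) $Q= K\rtimes_{\theta}^{\varphi}F$ (up to isomorphism) for some cocycle $\theta:F\times F\to K$ and some homomorphism $\varphi:F\to\mathrm{Aut}\,K$.
   Context: A loop is a set with a binary operation and two-sided neutral element $1$ such that $ax=b$ and $ya=b$ have unique solutions $x,y$ for all $a,b$. A subloop $S$ of $Q$ is normal, $S\unlhd Q$, if $xS=Sx$, $x(yS)=(xy)S$, $S(xy)=(Sx)y$ for all $x,y\in Q$; the factor loop $Q/S$ is defined as usual. The associator $[x,y,z]$ is defined by $(xy)z=(x(yz))[x,y,z]$. The nucleus $N(Q)$ consists of all $x\in Q$ with $[x,y,z]=[y,x,z]=[y,z,x]=1$ for all $y,z\in Q$. A loop $Q$ is an extension of $K$ by $F$ if $K\unlhd Q$ and $Q/K\cong F$. A map $\theta:F\times F\to K$ is a cocycle if $\theta(x,1)=\theta(1,x)=1$ for every $x\in F$. Given a cocycle $\theta:F\times F\to K$ and a homomorphism $\varphi:F\to\mathrm{Aut}\,K$, $x\mapsto\varphi_x$ (so $\varphi_{xy}=\varphi_x\varphi_y$), $K\rtimes_\theta^\varphi F$ denotes the groupoid $(K\times F,\circ)$ with $$(a,x)\circ(b,y)=(a\,\varphi_x(b)\,\theta(x,y),\,xy).$$ *)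

theory Defs
  imports "HOL-Algebra.Bij" "HOL-Algebra.Coset"
begin

text \<open>Loops are carried by the \<^typ>\<open>'a monoid\<close> records of HOL-Algebra, so that
  homomorphisms, isomorphisms, cosets and \<^term>\<open>G Mod H\<close> apply to them directly; none of these
  notions presupposes associativity.\<close>

locale loop =
  fixes G (structure)
  assumes m_closed [intro, simp]: "\<lbrakk>x \<in> carrier G; y \<in> carrier G\<rbrakk> \<Longrightarrow> x \<otimes> y \<in> carrier G"
    and one_closed [intro, simp]: "\<one> \<in> carrier G"
    and l_one [simp]: "x \<in> carrier G \<Longrightarrow> \<one> \<otimes> x = x"
    and r_one [simp]: "x \<in> carrier G \<Longrightarrow> x \<otimes> \<one> = x"
    and ex1_right_factor: "\<lbrakk>a \<in> carrier G; b \<in> carrier G\<rbrakk> \<Longrightarrow> \<exists>!x. x \<in> carrier G \<and> a \<otimes> x = b"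
    and ex1_left_factor: "\<lbrakk>a \<in> carrier G; b \<in> carrier G\<rbrakk> \<Longrightarrow> \<exists>!y. y \<in> carrier G \<and> y \<otimes> a = b"

definition subloop :: "'a set \<Rightarrow> ('a, 'b) monoid_scheme \<Rightarrow> bool"
  where "subloop S G \<longleftrightarrow> S \<subseteq> carrier G \<and> loop (G\<lparr>carrier := S\<rparr>)"

definition normal_subloop :: "'a set \<Rightarrow> ('a, 'b) monoid_scheme \<Rightarrow> bool"
  where "normal_subloop S G \<longleftrightarrow> subloop S G \<and>
    (\<forall>x \<in> carrier G. \<forall>y \<in> carrier G.
       x <#\<^bsub>G\<^esub> S = S #>\<^bsub>G\<^esub> x \<and>
       x <#\<^bsub>G\<^esub> (y <#\<^bsub>G\<^esub> S) = (x \<otimes>\<^bsub>G\<^esub> y) <#\<^bsub>G\<^esub> S \<and>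
       S #>\<^bsub>G\<^esub> (x \<otimes>\<^bsub>G\<^esub> y) = (S #>\<^bsub>G\<^esub> x) #>\<^bsub>G\<^esub> y)"

definition associator :: "('a, 'b) monoid_scheme \<Rightarrow> 'a \<Rightarrow> 'a \<Rightarrow> 'a \<Rightarrow> 'a"
  where "associator G x y z =
    (THE w. w \<in> carrier G \<and> (x \<otimes>\<^bsub>G\<^esub> y) \<otimes>\<^bsub>G\<^esub> z = (x \<otimes>\<^bsub>G\<^esub> (y \<otimes>\<^bsub>G\<^esub> z)) \<otimes>\<^bsub>G\<^esub> w)"

definition nucleus :: "('a, 'b) monoid_scheme \<Rightarrow> 'a set"
  where "nucleus G = {x \<in> carrier G. \<forall>y \<in> carrier G. \<forall>z \<in> carrier G.
    associator G x y z = \<one>\<^bsub>G\<^esub> \<and> associator G y x z = \<one>\<^bsub>G\<^esub> \<and> associator G y z x = \<one>\<^bsub>G\<^esub>}"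

definition loop_cocycle ::
    "('f, 'c) monoid_scheme \<Rightarrow> ('k, 'd) monoid_scheme \<Rightarrow> ('f \<times> 'f \<Rightarrow> 'k) \<Rightarrow> bool"
  where "loop_cocycle F K \<theta> \<longleftrightarrow> \<theta> \<in> carrier F \<times> carrier F \<rightarrow> carrier K \<and>
    (\<forall>x \<in> carrier F. \<theta> (x, \<one>\<^bsub>F\<^esub>) = \<one>\<^bsub>K\<^esub> \<and> \<theta> (\<one>\<^bsub>F\<^esub>, x) = \<one>\<^bsub>K\<^esub>)"

text \<open>The record type demands a \<^const>\<open>one\<close> field; it is filled with the pair of neutral
  elements. It plays no part in the groupoid structure and isomorphisms do not refer to it.\<close>

definition twisted_semidirect ::
    "('k, 'd) monoid_scheme \<Rightarrow> ('f, 'c) monoid_scheme \<Rightarrow> ('f \<times> 'f \<Rightarrow> 'k) \<Rightarrow> ('f \<Rightarrow> 'k \<Rightarrow> 'k)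
      \<Rightarrow> ('k \<times> 'f) monoid"
  where "twisted_semidirect K F \<theta> \<phi> =
    \<lparr>carrier = carrier K \<times> carrier F,
     mult = (\<lambda>(a, x) (b, y). (a \<otimes>\<^bsub>K\<^esub> \<phi> x b \<otimes>\<^bsub>K\<^esub> \<theta> (x, y), x \<otimes>\<^bsub>F\<^esub> y)),
     one = (\<one>\<^bsub>K\<^esub>, \<one>\<^bsub>F\<^esub>)\<rparr>"

text \<open>For a normal subloop, the complex product used by \<^term>\<open>G Mod S\<close> is the usual product
  of cosets.\<close>

lemma normal_subloop_rcos_mult:
  assumes "loop G" and N: "normal_subloop S G" and x: "x \<in> carrier G" and y: "y \<in> carrier G"
  shows "(S #>\<^bsub>G\<^esub> x) <#>\<^bsub>G\<^esub> (S #>\<^bsub>G\<^esub> y) = S #>\<^bsub>G\<^esub> (x \<otimes>\<^bsub>G\<^esub> y)"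
proof -
  interpret loop G by fact
  interpret S: loop "G\<lparr>carrier := S\<rparr>" using N by (simp add: normal_subloop_def subloop_def)
  have sub: "S \<subseteq> carrier G" using N by (simp add: normal_subloop_def subloop_def)
  have comm: "a <#\<^bsub>G\<^esub> S = S #>\<^bsub>G\<^esub> a" if "a \<in> carrier G" for a
    using N that unfolding normal_subloop_def by blast
  have lassoc: "a <#\<^bsub>G\<^esub> (b <#\<^bsub>G\<^esub> S) = (a \<otimes>\<^bsub>G\<^esub> b) <#\<^bsub>G\<^esub> S"
    if "a \<in> carrier G" "b \<in> carrier G" for a b
    using N that unfolding normal_subloop_def by blast
  have rassoc: "S #>\<^bsub>G\<^esub> (a \<otimes>\<^bsub>G\<^esub> b) = (S #>\<^bsub>G\<^esub> a) #>\<^bsub>G\<^esub> b"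
    if "a \<in> carrier G" "b \<in> carrier G" for a b
    using N that unfolding normal_subloop_def by blast
  have absorb: "S #>\<^bsub>G\<^esub> u = S" if "u \<in> S" for u
  proof
    show "S #>\<^bsub>G\<^esub> u \<subseteq> S" using S.m_closed that by (auto simp: r_coset_def)
    show "S \<subseteq> S #>\<^bsub>G\<^esub> u"
    proof
      fix v assume "v \<in> S"
      with that obtain w where "w \<in> S" "w \<otimes>\<^bsub>G\<^esub> u = v"
        using S.ex1_left_factor[of u v] by auto
      then show "v \<in> S #>\<^bsub>G\<^esub> u" unfolding r_coset_def by blast
    qed
  qed
  have step: "(s \<otimes>\<^bsub>G\<^esub> x) <#\<^bsub>G\<^esub> (S #>\<^bsub>G\<^esub> y) = S #>\<^bsub>G\<^esub> (x \<otimes>\<^bsub>G\<^esub> y)" if s: "s \<in> S" for s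
  proof -
    have sG: "s \<in> carrier G" using s sub by auto
    have "(s \<otimes>\<^bsub>G\<^esub> x) \<otimes>\<^bsub>G\<^esub> y \<in> S #>\<^bsub>G\<^esub> (x \<otimes>\<^bsub>G\<^esub> y)"
      unfolding rassoc[OF x y] using s by (auto simp: r_coset_def)
    then obtain u where u: "u \<in> S" "(s \<otimes>\<^bsub>G\<^esub> x) \<otimes>\<^bsub>G\<^esub> y = u \<otimes>\<^bsub>G\<^esub> (x \<otimes>\<^bsub>G\<^esub> y)"
      by (auto simp: r_coset_def)
    have uG: "u \<in> carrier G" using u sub by auto
    have "(s \<otimes>\<^bsub>G\<^esub> x) <#\<^bsub>G\<^esub> (S #>\<^bsub>G\<^esub> y) = S #>\<^bsub>G\<^esub> ((s \<otimes>\<^bsub>G\<^esub> x) \<otimes>\<^bsub>G\<^esub> y)"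
      using comm[OF y] comm[of "(s \<otimes>\<^bsub>G\<^esub> x) \<otimes>\<^bsub>G\<^esub> y"]
        lassoc[of "s \<otimes>\<^bsub>G\<^esub> x" y] sG x y by simp
    also have "\<dots> = (S #>\<^bsub>G\<^esub> u) #>\<^bsub>G\<^esub> (x \<otimes>\<^bsub>G\<^esub> y)"
      unfolding u(2) using rassoc[of u "x \<otimes>\<^bsub>G\<^esub> y"] uG x y by simp
    finally show ?thesis using absorb[OF u(1)] by simp
  qed
  have "(S #>\<^bsub>G\<^esub> x) <#>\<^bsub>G\<^esub> (S #>\<^bsub>G\<^esub> y) = (\<Union>s\<in>S. (s \<otimes>\<^bsub>G\<^esub> x) <#\<^bsub>G\<^esub> (S #>\<^bsub>G\<^esub> y))"
    by (auto simp: set_mult_def r_coset_def l_coset_def)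
  also have "\<dots> = S #>\<^bsub>G\<^esub> (x \<otimes>\<^bsub>G\<^esub> y)"
    using step S.one_closed by auto
  finally show ?thesis .
qed

end

theory Submission
  imports Defs
begin

text \<open>
  Both conditions say that there is a short exact sequence of loops
  \<open>1 \<longrightarrow> K \<longrightarrow> Q \<longrightarrow> F \<longrightarrow> 1\<close>, with maps \<open>i\<close> and \<open>p\<close>, in which every element \<open>i a\<close> may be
  moved freely through parentheses; this is the locale \<open>nuclear_extension\<close>.  That condition (i)
  amounts to such a sequence is the homomorphism theorem for loops, kernels being
  normal with the expected factor loop (\<open>normal_subloop_kernel\<close>, \<open>kernel_Mod_iso\<close>), and normal
  subloops being kernels (\<open>normal_subloop_rcos_hom\<close>, \<open>normal_subloop_rcos_eq_iff\<close>).

  In a nuclear extension the classical argument for group extensions goes through, because the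
  products to be reassociated always have a factor in \<open>i ` K\<close>.  Since \<open>q \<otimes> i b\<close> and \<open>q\<close> have
  the same image in \<open>F\<close>, there is a unique \<open>c\<close> with \<open>q \<otimes> i b = i c \<otimes> q\<close>; the map \<open>b \<mapsto> c\<close> is an
  automorphism of \<open>K\<close>, depends multiplicatively on \<open>q\<close>, and is trivial for \<open>q \<in> i ` K\<close> because
  \<open>K\<close> is abelian.  Hence it depends on \<open>p q\<close> alone and is a homomorphism \<open>\<phi>\<close> from \<open>F\<close> to the
  automorphisms.  A section \<open>t\<close> of \<open>p\<close> with \<open>t \<one> = \<one>\<close> gives a cocycle through
  \<open>t x \<otimes> t y = i (\<theta> (x, y)) \<otimes> t (x \<otimes> y)\<close>, and writing each \<open>q\<close> as \<open>i a \<otimes> t x\<close> identifies \<open>Q\<close>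
  with the twisted semidirect product.  Unlike in group theory, normalisation is all that can be
  said of \<open>\<theta>\<close>: the usual cocycle identity expresses associativity of the section elements among
  themselves, which a loop need not have.

  Conversely, the second projection of a twisted semidirect product is a homomorphism onto \<open>F\<close>
  whose kernel is the first factor, and this kernel lies in the nucleus by the three computations
  of \<open>twisted_semidirect_nuclear\<close>; there \<open>\<theta>\<close> occurs only with an argument \<open>\<one>\<close> or as one common
  factor of both sides.
\<close>

section \<open>Loops, nuclei and kernels\<close>

context loop
begin

lemma l_cancel_iff:
  assumes "a \<in> carrier G" "x \<in> carrier G" "y \<in> carrier G"
  shows "a \<otimes> x = a \<otimes> y \<longleftrightarrow> x = y"
  using ex1_right_factor[of a "a \<otimes> x"] assms by (metis m_closed)

lemma r_cancel_iff:
  assumes "a \<in> carrier G" "x \<in> carrier G" "y \<in> carrier G"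
  shows "x \<otimes> a = y \<otimes> a \<longleftrightarrow> x = y"
  using ex1_left_factor[of a "x \<otimes> a"] assms by (metis m_closed)

lemma idempotent_one:
  assumes "x \<in> carrier G" "x \<otimes> x = x"
  shows "x = \<one>"
  using assms l_cancel_iff[of x x \<one>] by simp

lemma associator_eq_one_iff:
  assumes "x \<in> carrier G" "y \<in> carrier G" "z \<in> carrier G"
  shows "associator G x y z = \<one> \<longleftrightarrow> (x \<otimes> y) \<otimes> z = x \<otimes> (y \<otimes> z)"
proof -
  have ex: "\<exists>!w. w \<in> carrier G \<and> (x \<otimes> (y \<otimes> z)) \<otimes> w = (x \<otimes> y) \<otimes> z"
    using assms by (intro ex1_right_factor) auto
  have eq: "associator G x y z = (THE w. w \<in> carrier G \<and> (x \<otimes> (y \<otimes> z)) \<otimes> w = (x \<otimes> y) \<otimes> z)"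
    unfolding associator_def by (intro arg_cong[where f = The] ext) auto
  show ?thesis
  proof
    assume "associator G x y z = \<one>"
    with theI'[OF ex] have "x \<otimes> (y \<otimes> z) \<otimes> \<one> = (x \<otimes> y) \<otimes> z" unfolding eq by simp
    then show "(x \<otimes> y) \<otimes> z = x \<otimes> (y \<otimes> z)" using assms by simp
  next
    assume "(x \<otimes> y) \<otimes> z = x \<otimes> (y \<otimes> z)"
    then show "associator G x y z = \<one>"
      unfolding eq using assms by (intro the1_equality[OF ex]) auto
  qed
qed

lemma nucleus_iff:
  "x \<in> nucleus G \<longleftrightarrow> x \<in> carrier G \<and> (\<forall>y \<in> carrier G. \<forall>z \<in> carrier G.
     (x \<otimes> y) \<otimes> z = x \<otimes> (y \<otimes> z) \<and> (y \<otimes> x) \<otimes> z = y \<otimes> (x \<otimes> z) \<and> (y \<otimes> z) \<otimes> x = y \<otimes> (z \<otimes> x))"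
  unfolding nucleus_def by (auto simp: associator_eq_one_iff)

end

text \<open>Preservation of the neutral element is automatic for homomorphisms into a loop, since the
  neutral element is the only idempotent.\<close>

locale loop_hom = G: loop G + H: loop H for G (structure) and H (structure) +
  fixes p
  assumes homh: "p \<in> hom G H"
begin

lemma hom_closed [simp]: "x \<in> carrier G \<Longrightarrow> p x \<in> carrier H"
  using homh by (auto simp: hom_def)

lemma hom_mult [simp]: "x \<in> carrier G \<Longrightarrow> y \<in> carrier G \<Longrightarrow> p (x \<otimes> y) = p x \<otimes>\<^bsub>H\<^esub> p y"
  using homh by (auto simp: hom_def)

lemma hom_one [simp]: "p \<one> = \<one>\<^bsub>H\<^esub>"
  using hom_mult[of \<one> \<one>] by (intro H.idempotent_one) auto

lemma kernel_iff: "s \<in> kernel G H p \<longleftrightarrow> s \<in> carrier G \<and> p s = \<one>\<^bsub>H\<^esub>"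
  by (simp add: kernel_def)

lemma kernel_left_factor:
  assumes "x \<in> carrier G" "q \<in> carrier G" "p q = p x"
  obtains s where "s \<in> kernel G H p" "s \<otimes> x = q"
proof -
  obtain s where s: "s \<in> carrier G" "s \<otimes> x = q" using assms G.ex1_left_factor by metis
  then have "p s \<otimes>\<^bsub>H\<^esub> p x = \<one>\<^bsub>H\<^esub> \<otimes>\<^bsub>H\<^esub> p x"
    using assms hom_mult[of s x] by simp
  then have "p s = \<one>\<^bsub>H\<^esub>" using s assms H.r_cancel_iff[of "p x" "p s" "\<one>\<^bsub>H\<^esub>"] by simp
  then show thesis using s that by (simp add: kernel_iff)
qed

lemma kernel_right_factor:
  assumes "x \<in> carrier G" "q \<in> carrier G" "p q = p x"
  obtains s where "s \<in> kernel G H p" "x \<otimes> s = q"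
proof -
  obtain s where s: "s \<in> carrier G" "x \<otimes> s = q" using assms G.ex1_right_factor by metis
  then have "p x \<otimes>\<^bsub>H\<^esub> p s = p x \<otimes>\<^bsub>H\<^esub> \<one>\<^bsub>H\<^esub>"
    using assms hom_mult[of x s] by simp
  then have "p s = \<one>\<^bsub>H\<^esub>" using s assms H.l_cancel_iff[of "p x" "p s" "\<one>\<^bsub>H\<^esub>"] by simp
  then show thesis using s that by (simp add: kernel_iff)
qed

lemma kernel_r_coset:
  assumes "x \<in> carrier G"
  shows "kernel G H p #> x = {q \<in> carrier G. p q = p x}"
proof (intro equalityI subsetI)
  fix q assume "q \<in> {q \<in> carrier G. p q = p x}"
  then obtain s where "s \<in> kernel G H p" "s \<otimes> x = q"
    using kernel_left_factor[OF assms] by blast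
  then show "q \<in> kernel G H p #> x" by (auto simp: r_coset_def)
qed (use assms in \<open>auto simp: r_coset_def kernel_iff\<close>)

lemma kernel_l_coset:
  assumes "x \<in> carrier G"
  shows "x <# kernel G H p = {q \<in> carrier G. p q = p x}"
proof (intro equalityI subsetI)
  fix q assume "q \<in> {q \<in> carrier G. p q = p x}"
  then obtain s where "s \<in> kernel G H p" "x \<otimes> s = q"
    using kernel_right_factor[OF assms] by blast
  then show "q \<in> x <# kernel G H p" by (auto simp: l_coset_def)
qed (use assms in \<open>auto simp: l_coset_def kernel_iff\<close>)

lemma subloop_kernel: "subloop (kernel G H p) G"
proof -
  have "loop (G\<lparr>carrier := kernel G H p\<rparr>)"
  proof
    fix a b assume "a \<in> carrier (G\<lparr>carrier := kernel G H p\<rparr>)"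
      "b \<in> carrier (G\<lparr>carrier := kernel G H p\<rparr>)"
    then have ab: "a \<in> carrier G" "b \<in> carrier G" "p b = p a" "a \<in> kernel G H p"
      by (auto simp: kernel_iff)
    show "\<exists>!x. x \<in> carrier (G\<lparr>carrier := kernel G H p\<rparr>) \<and>
        a \<otimes>\<^bsub>G\<lparr>carrier := kernel G H p\<rparr>\<^esub> x = b"
      using kernel_right_factor[OF ab(1-3)] ab(1) G.l_cancel_iff
      by (simp, metis kernel_iff)
    show "\<exists>!x. x \<in> carrier (G\<lparr>carrier := kernel G H p\<rparr>) \<and>
        x \<otimes>\<^bsub>G\<lparr>carrier := kernel G H p\<rparr>\<^esub> a = b"
      using kernel_left_factor[OF ab(1-3)] ab(1) G.r_cancel_iff
      by (simp, metis kernel_iff)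
  qed (auto simp: kernel_iff)
  then show ?thesis by (auto simp: subloop_def kernel_iff)
qed

text \<open>Every coset appearing in the definition of normality is a fibre of \<open>p\<close>, so the required
  equations compare fibres over the same point.\<close>

lemma normal_subloop_kernel: "normal_subloop (kernel G H p) G"
proof -
  have r: "(kernel G H p #> x) #> y = {q \<in> carrier G. p q = p (x \<otimes> y)}"
    if x: "x \<in> carrier G" and y: "y \<in> carrier G" for x y
  proof (intro equalityI subsetI)
    fix q assume "q \<in> {q \<in> carrier G. p q = p (x \<otimes> y)}"
    then have q: "q \<in> carrier G" "p q = p x \<otimes>\<^bsub>H\<^esub> p y" using x y by auto
    obtain u where u: "u \<in> carrier G" "u \<otimes> y = q" using q y G.ex1_left_factor by metis
    then have "p u = p x" using q x y H.r_cancel_iff[of "p y" "p u" "p x"] hom_mult[of u y] by simp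
    then have "u \<in> kernel G H p #> x" using kernel_r_coset x u by blast
    then show "q \<in> (kernel G H p #> x) #> y" using u by (auto simp: r_coset_def)
  qed (use x y in \<open>auto simp: r_coset_def kernel_iff\<close>)
  have l: "x <# (y <# kernel G H p) = {q \<in> carrier G. p q = p (x \<otimes> y)}"
    if x: "x \<in> carrier G" and y: "y \<in> carrier G" for x y
  proof (intro equalityI subsetI)
    fix q assume "q \<in> {q \<in> carrier G. p q = p (x \<otimes> y)}"
    then have q: "q \<in> carrier G" "p q = p x \<otimes>\<^bsub>H\<^esub> p y" using x y by auto
    obtain u where u: "u \<in> carrier G" "x \<otimes> u = q" using q x G.ex1_right_factor by metis
    then have "p u = p y" using q x y H.l_cancel_iff[of "p x" "p u" "p y"] hom_mult[of x u] by simp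
    then have "u \<in> y <# kernel G H p" using kernel_l_coset y u by blast
    then show "q \<in> x <# (y <# kernel G H p)" using u by (auto simp: l_coset_def)
  qed (use x y in \<open>auto simp: l_coset_def kernel_iff\<close>)
  show ?thesis
    unfolding normal_subloop_def
  proof (intro conjI ballI)
    fix x y assume x: "x \<in> carrier G" and y: "y \<in> carrier G"
    show "x <# kernel G H p = kernel G H p #> x"
      using x by (simp add: kernel_r_coset kernel_l_coset)
    show "x <# (y <# kernel G H p) = (x \<otimes> y) <# kernel G H p"
      unfolding l[OF x y] kernel_l_coset[OF G.m_closed[OF x y]] ..
    show "kernel G H p #> (x \<otimes> y) = (kernel G H p #> x) #> y"
      unfolding r[OF x y] kernel_r_coset[OF G.m_closed[OF x y]] ..
  qed (rule subloop_kernel)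
qed

text \<open>The cosets are exactly the fibres of \<open>p\<close>, so the induced map may be evaluated as the single
  element of the image of a coset.\<close>

lemma kernel_Mod_iso:
  assumes surj: "p ` carrier G = carrier H"
  shows "G Mod kernel G H p \<cong> H"
proof -
  let ?S = "kernel G H p"
  have val: "the_elem (p ` (?S #> x)) = p x" if x: "x \<in> carrier G" for x
  proof -
    have "p ` (?S #> x) = {p x}" unfolding kernel_r_coset[OF x] using x by auto
    then show ?thesis by simp
  qed
  have carr: "carrier (G Mod ?S) = (\<lambda>x. ?S #> x) ` carrier G"
    by (rule carrier_FactGroup)
  have "(\<lambda>C. the_elem (p ` C)) \<in> iso (G Mod ?S) H"
  proof (rule isoI)
    show "(\<lambda>C. the_elem (p ` C)) \<in> hom (G Mod ?S) H"
    proof (rule homI)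
      fix C D assume "C \<in> carrier (G Mod ?S)" "D \<in> carrier (G Mod ?S)"
      then obtain x y where x: "x \<in> carrier G" "C = ?S #> x" and y: "y \<in> carrier G" "D = ?S #> y"
        unfolding carr by blast
      have "C \<otimes>\<^bsub>G Mod ?S\<^esub> D = ?S #> (x \<otimes> y)"
        using normal_subloop_rcos_mult[OF G.loop_axioms normal_subloop_kernel] x y
        by (simp add: FactGroup_def)
      then show "the_elem (p ` (C \<otimes>\<^bsub>G Mod ?S\<^esub> D)) = the_elem (p ` C) \<otimes>\<^bsub>H\<^esub> the_elem (p ` D)"
        using x y by (simp add: val)
    qed (auto simp: carr val)
    have "inj_on (\<lambda>C. the_elem (p ` C)) (carrier (G Mod ?S))"
    proof (rule inj_onI)
      fix C D assume "C \<in> carrier (G Mod ?S)" "D \<in> carrier (G Mod ?S)"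
        and eq: "the_elem (p ` C) = the_elem (p ` D)"
      then obtain x y where x: "x \<in> carrier G" "C = ?S #> x" and y: "y \<in> carrier G" "D = ?S #> y"
        unfolding carr by blast
      with eq have "p x = p y" by (simp add: val)
      then show "C = D" using x y by (simp add: kernel_r_coset)
    qed
    moreover have "(\<lambda>C. the_elem (p ` C)) ` carrier (G Mod ?S) = carrier H"
      unfolding carr image_image surj[symmetric] by (intro image_cong) (auto simp: val)
    ultimately show "bij_betw (\<lambda>C. the_elem (p ` C)) (carrier (G Mod ?S)) (carrier H)"
      by (simp add: bij_betw_def)
  qed
  then show ?thesis by (auto simp: is_iso_def)
qed

end

lemma normal_subloop_rcos_hom:
  assumes "loop G" "normal_subloop S G"
  shows "(\<lambda>x. S #>\<^bsub>G\<^esub> x) \<in> hom G (G Mod S)"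
  by (rule homI) (auto simp: FactGroup_def RCOSETS_def normal_subloop_rcos_mult[OF assms])

lemma normal_subloop_rcos_eq_iff:
  assumes "loop G" "normal_subloop S G" and x: "x \<in> carrier G"
  shows "S #>\<^bsub>G\<^esub> x = S #>\<^bsub>G\<^esub> \<one>\<^bsub>G\<^esub> \<longleftrightarrow> x \<in> S"
proof -
  interpret loop G by fact
  interpret S: loop "G\<lparr>carrier := S\<rparr>" using assms by (simp add: normal_subloop_def subloop_def)
  have sub: "S \<subseteq> carrier G" using assms by (simp add: normal_subloop_def subloop_def)
  have one: "S #>\<^bsub>G\<^esub> \<one>\<^bsub>G\<^esub> = S" using sub by (force simp: r_coset_def)
  show ?thesis unfolding one
  proof
    assume "S #>\<^bsub>G\<^esub> x = S"
    moreover have "\<one>\<^bsub>G\<^esub> \<otimes>\<^bsub>G\<^esub> x \<in> S #>\<^bsub>G\<^esub> x" using S.one_closed unfolding r_coset_def by auto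
    ultimately show "x \<in> S" using x by simp
  next
    assume xS: "x \<in> S"
    show "S #>\<^bsub>G\<^esub> x = S"
    proof
      show "S #>\<^bsub>G\<^esub> x \<subseteq> S" using S.m_closed xS by (auto simp: r_coset_def)
      show "S \<subseteq> S #>\<^bsub>G\<^esub> x"
      proof
        fix v assume "v \<in> S"
        then obtain w where "w \<in> S" "w \<otimes>\<^bsub>G\<^esub> x = v"
          using S.ex1_left_factor[of x v] xS by auto
        then show "v \<in> S #>\<^bsub>G\<^esub> x" unfolding r_coset_def by blast
      qed
    qed
  qed
qed

section \<open>Nuclear extensions\<close>

text \<open>A short exact sequence with kernel in the nucleus.  Keeping \<open>K\<close> separate from its image
  under \<open>i\<close> lets the action and the cocycle take values in \<open>K\<close> itself.\<close>

locale nuclear_extension = loop_hom Q F p + K: comm_group K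
  for Q (structure) and F (structure) and p and K (structure) +
  fixes i
  assumes i_hom: "i \<in> hom K Q"
    and i_inj: "inj_on i (carrier K)"
    and i_kernel: "i ` carrier K = kernel Q F p"
    and i_nucleus: "i ` carrier K \<subseteq> nucleus Q"
    and p_surj: "p ` carrier Q = carrier F"
begin

lemma i_closed [simp]: "a \<in> carrier K \<Longrightarrow> i a \<in> carrier Q"
  using i_hom by (auto simp: hom_def)

lemma i_mult: "a \<in> carrier K \<Longrightarrow> b \<in> carrier K \<Longrightarrow> i (a \<otimes>\<^bsub>K\<^esub> b) = i a \<otimes> i b"
  using i_hom by (auto simp: hom_def)

lemma p_i [simp]: "a \<in> carrier K \<Longrightarrow> p (i a) = \<one>\<^bsub>F\<^esub>"
  using i_kernel by (auto simp: kernel_iff)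

lemma i_eq_iff: "a \<in> carrier K \<Longrightarrow> b \<in> carrier K \<Longrightarrow> i a = i b \<longleftrightarrow> a = b"
  using i_inj by (auto simp: inj_on_def)

lemma i_one: "i \<one>\<^bsub>K\<^esub> = \<one>"
  using i_mult[of "\<one>\<^bsub>K\<^esub>" "\<one>\<^bsub>K\<^esub>"] by (intro G.idempotent_one) auto

lemma nuclear:
  assumes "a \<in> carrier K" "x \<in> carrier Q" "y \<in> carrier Q"
  shows "(i a \<otimes> x) \<otimes> y = i a \<otimes> (x \<otimes> y)" "(x \<otimes> i a) \<otimes> y = x \<otimes> (i a \<otimes> y)"
    "(x \<otimes> y) \<otimes> i a = x \<otimes> (y \<otimes> i a)"
  using i_nucleus assms unfolding G.nucleus_iff subset_iff by blast+

definition ratio where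
  "ratio q q' = (THE a. a \<in> carrier K \<and> i a \<otimes> q' = q)"

lemma ratio_eqI:
  assumes "a \<in> carrier K" "q' \<in> carrier Q" "i a \<otimes> q' = q"
  shows "ratio q q' = a"
  unfolding ratio_def
  using assms by (intro the_equality) (auto simp: G.r_cancel_iff i_eq_iff)

lemma
  assumes "q \<in> carrier Q" "q' \<in> carrier Q" "p q = p q'"
  shows ratio_closed: "ratio q q' \<in> carrier K"
    and i_ratio: "i (ratio q q') \<otimes> q' = q"
proof -
  obtain s where "s \<in> i ` carrier K" "s \<otimes> q' = q"
    using kernel_left_factor[of q' q] assms i_kernel by metis
  then obtain a where "a \<in> carrier K" "i a \<otimes> q' = q" by blast
  moreover from this have "ratio q q' = a" using assms by (intro ratio_eqI)
  ultimately show "ratio q q' \<in> carrier K" "i (ratio q q') \<otimes> q' = q" by auto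
qed

text \<open>The action of \<open>Q\<close> on \<open>K\<close> by conjugation, restricted to the carrier because
  \<^const>\<open>AutoGroup\<close> consists of extensional functions.\<close>

definition act where
  "act q = (\<lambda>b \<in> carrier K. ratio (q \<otimes> i b) q)"

lemma act_closed [simp]: "q \<in> carrier Q \<Longrightarrow> b \<in> carrier K \<Longrightarrow> act q b \<in> carrier K"
  unfolding act_def by (auto intro: ratio_closed)

lemma i_act: "q \<in> carrier Q \<Longrightarrow> b \<in> carrier K \<Longrightarrow> i (act q b) \<otimes> q = q \<otimes> i b"
  unfolding act_def by (auto intro: i_ratio)

lemma act_eqI:
  assumes "q \<in> carrier Q" "b \<in> carrier K" "c \<in> carrier K" "i c \<otimes> q = q \<otimes> i b"
  shows "act q b = c"
  unfolding act_def using assms by (simp add: ratio_eqI)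

lemma act_hom:
  assumes q: "q \<in> carrier Q"
  shows "act q \<in> hom K K"
proof (rule homI)
  fix b c assume b: "b \<in> carrier K" and c: "c \<in> carrier K"
  have "i (act q b \<otimes>\<^bsub>K\<^esub> act q c) \<otimes> q = i (act q b) \<otimes> (i (act q c) \<otimes> q)"
    using q b c by (simp add: i_mult nuclear)
  also have "\<dots> = (i (act q b) \<otimes> q) \<otimes> i c"
    using q b c by (simp add: i_act[OF q c] nuclear)
  also have "\<dots> = (q \<otimes> i b) \<otimes> i c"
    using q b by (simp add: i_act)
  also have "\<dots> = q \<otimes> i (b \<otimes>\<^bsub>K\<^esub> c)"
    using q b c by (simp add: i_mult nuclear)
  finally show "act q (b \<otimes>\<^bsub>K\<^esub> c) = act q b \<otimes>\<^bsub>K\<^esub> act q c"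
    using q b c by (intro act_eqI) auto
qed (use q in simp)

lemma act_auto:
  assumes q: "q \<in> carrier Q"
  shows "act q \<in> auto K"
proof -
  have "inj_on (act q) (carrier K)"
  proof (rule inj_onI)
    fix b c assume bc: "b \<in> carrier K" "c \<in> carrier K" "act q b = act q c"
    then have "q \<otimes> i b = q \<otimes> i c" using i_act[OF q] by metis
    then show "b = c" using q bc by (simp add: G.l_cancel_iff i_eq_iff)
  qed
  moreover have "act q ` carrier K = carrier K"
  proof (intro equalityI subsetI)
    fix c assume c: "c \<in> carrier K"
    obtain s where "s \<in> i ` carrier K" "q \<otimes> s = i c \<otimes> q"
      using kernel_right_factor[of q "i c \<otimes> q"] q c i_kernel by auto
    then obtain b where b: "b \<in> carrier K" "q \<otimes> i b = i c \<otimes> q" by blast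
    then have "act q b = c" using q c by (intro act_eqI) auto
    then show "c \<in> act q ` carrier K" using b by blast
  qed (use q in auto)
  ultimately have "act q \<in> Bij (carrier K)"
    unfolding Bij_def bij_betw_def by (simp add: act_def)
  then show ?thesis using act_hom[OF q] by (simp add: auto_def)
qed

lemma act_mult:
  assumes q: "q \<in> carrier Q" and r: "r \<in> carrier Q" and b: "b \<in> carrier K"
  shows "act (q \<otimes> r) b = act q (act r b)"
proof (rule act_eqI)
  have "i (act q (act r b)) \<otimes> (q \<otimes> r) = (q \<otimes> i (act r b)) \<otimes> r"
    using q r b by (simp add: nuclear(1)[symmetric] i_act)
  also have "\<dots> = (q \<otimes> r) \<otimes> i b"
    using q r b by (simp add: nuclear i_act)
  finally show "i (act q (act r b)) \<otimes> (q \<otimes> r) = (q \<otimes> r) \<otimes> i b" .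
qed (use assms in auto)

text \<open>Two elements over the same point of \<open>F\<close> differ by an element of the image of \<open>K\<close>, which
  acts trivially since \<open>K\<close> is abelian.\<close>

lemma act_cong:
  assumes q: "q \<in> carrier Q" and r: "r \<in> carrier Q" and eq: "p q = p r"
  shows "act q = act r"
proof
  fix b
  let ?a = "ratio q r"
  note a = ratio_closed[OF assms]
  show "act q b = act r b"
  proof (cases "b \<in> carrier K")
    case True
    have triv: "act (i ?a) c = c" if "c \<in> carrier K" for c
      using that a by (intro act_eqI) (auto simp: i_mult[symmetric] K.m_comm)
    have "act q b = act (i ?a \<otimes> r) b" using i_ratio[OF assms] by simp
    also have "\<dots> = act r b" using a r True by (simp add: act_mult triv)
    finally show ?thesis .
  qed (simp add: act_def)
qed

text \<open>The section is normalised at \<open>\<one>\<close> so that the resulting cocycle is.\<close>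

definition sect where
  "sect x = (if x = \<one>\<^bsub>F\<^esub> then \<one> else inv_into (carrier Q) p x)"

lemma sect_closed [simp]: "x \<in> carrier F \<Longrightarrow> sect x \<in> carrier Q"
  and p_sect [simp]: "x \<in> carrier F \<Longrightarrow> p (sect x) = x"
  unfolding sect_def using p_surj by (auto intro: inv_into_into f_inv_into_f)

lemma sect_one [simp]: "sect \<one>\<^bsub>F\<^esub> = \<one>"
  by (simp add: sect_def)

definition cocycle where
  "cocycle = (\<lambda>(x, y). ratio (sect x \<otimes> sect y) (sect (x \<otimes>\<^bsub>F\<^esub> y)))"

lemma cocycle_closed [simp]: "x \<in> carrier F \<Longrightarrow> y \<in> carrier F \<Longrightarrow> cocycle (x, y) \<in> carrier K"
  unfolding cocycle_def by (auto intro: ratio_closed)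

lemma i_cocycle:
  "x \<in> carrier F \<Longrightarrow> y \<in> carrier F \<Longrightarrow>
    i (cocycle (x, y)) \<otimes> sect (x \<otimes>\<^bsub>F\<^esub> y) = sect x \<otimes> sect y"
  unfolding cocycle_def by (auto intro: i_ratio)

lemma loop_cocycle: "loop_cocycle F K cocycle"
  unfolding loop_cocycle_def
  by (auto simp: i_one cocycle_def intro!: ratio_eqI intro: ratio_closed)

lemma act_sect_hom: "(\<lambda>x. act (sect x)) \<in> hom F (AutoGroup K)"
proof (rule homI)
  fix x assume "x \<in> carrier F"
  then show "act (sect x) \<in> carrier (AutoGroup K)" by (simp add: AutoGroup_def act_auto)
next
  fix x y assume x: "x \<in> carrier F" and y: "y \<in> carrier F"
  have Bij: "act (sect x) \<in> Bij (carrier K)" "act (sect y) \<in> Bij (carrier K)"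
    using x y act_auto by (auto simp: auto_def)
  have "act (sect (x \<otimes>\<^bsub>F\<^esub> y)) = act (sect x \<otimes> sect y)"
    using x y by (intro act_cong) auto
  also have "\<dots> = compose (carrier K) (act (sect x)) (act (sect y))"
  proof
    fix b
    show "act (sect x \<otimes> sect y) b = compose (carrier K) (act (sect x)) (act (sect y)) b"
      using x y by (cases "b \<in> carrier K") (auto simp: act_mult compose_def, simp add: act_def)
  qed
  finally show "act (sect (x \<otimes>\<^bsub>F\<^esub> y)) = act (sect x) \<otimes>\<^bsub>AutoGroup K\<^esub> act (sect y)"
    using Bij by (simp add: AutoGroup_def BijGroup_def)
qed

text \<open>Collecting the factors from the image of \<open>K\<close> on the left never reassociates three section
  elements, so nuclearity suffices.\<close>

lemma i_sect_mult:
  assumes x: "x \<in> carrier F" and y: "y \<in> carrier F" and a: "a \<in> carrier K" and b: "b \<in> carrier K"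
  shows "(i a \<otimes> sect x) \<otimes> (i b \<otimes> sect y)
    = i (a \<otimes>\<^bsub>K\<^esub> act (sect x) b \<otimes>\<^bsub>K\<^esub> cocycle (x, y)) \<otimes> sect (x \<otimes>\<^bsub>F\<^esub> y)"
proof -
  have "(i a \<otimes> sect x) \<otimes> (i b \<otimes> sect y) = i a \<otimes> ((sect x \<otimes> i b) \<otimes> sect y)"
    using assms by (simp add: nuclear)
  also have "\<dots> = i a \<otimes> ((i (act (sect x) b) \<otimes> sect x) \<otimes> sect y)"
    using assms by (simp add: i_act)
  also have "\<dots> = i a \<otimes> (i (act (sect x) b) \<otimes> (i (cocycle (x, y)) \<otimes> sect (x \<otimes>\<^bsub>F\<^esub> y)))"
    using assms by (simp add: nuclear i_cocycle)
  also have "\<dots> = i (a \<otimes>\<^bsub>K\<^esub> act (sect x) b \<otimes>\<^bsub>K\<^esub> cocycle (x, y)) \<otimes> sect (x \<otimes>\<^bsub>F\<^esub> y)"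
    using assms by (simp add: nuclear i_mult)
  finally show ?thesis .
qed

lemma iso_twisted_semidirect:
  "Q \<cong> twisted_semidirect K F cocycle (\<lambda>x. act (sect x))" (is "Q \<cong> ?P")
proof -
  \<comment> \<open>The \<open>K\<close>-coordinate of \<open>q\<close> in the decomposition \<open>q = i a \<otimes> sect x\<close>.\<close>
  define d where "d q = ratio q (sect (p q))" for q
  have d_closed: "d q \<in> carrier K" and i_d: "i (d q) \<otimes> sect (p q) = q"
    if "q \<in> carrier Q" for q
    using that unfolding d_def by (auto intro: ratio_closed i_ratio)
  have d_eqI: "d q = a" if "q \<in> carrier Q" "a \<in> carrier K" "i a \<otimes> sect (p q) = q" for q a
    using that unfolding d_def by (intro ratio_eqI) auto
  have "(\<lambda>q. (d q, p q)) \<in> iso Q ?P"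
  proof (rule isoI)
    show "(\<lambda>q. (d q, p q)) \<in> hom Q ?P"
    proof (rule homI)
      fix q r assume q: "q \<in> carrier Q" and r: "r \<in> carrier Q"
      have "d (q \<otimes> r) = d q \<otimes>\<^bsub>K\<^esub> act (sect (p q)) (d r) \<otimes>\<^bsub>K\<^esub> cocycle (p q, p r)"
        using q r i_sect_mult[of "p q" "p r" "d q" "d r"]
        by (intro d_eqI) (auto simp: d_closed i_d)
      then show "(d (q \<otimes> r), p (q \<otimes> r)) = (d q, p q) \<otimes>\<^bsub>?P\<^esub> (d r, p r)"
        using q r by (simp add: twisted_semidirect_def)
    qed (auto simp: twisted_semidirect_def d_closed)
    have "inj_on (\<lambda>q. (d q, p q)) (carrier Q)"
      by (rule inj_onI) (metis i_d prod.inject)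
    moreover have "(\<lambda>q. (d q, p q)) ` carrier Q = carrier K \<times> carrier F"
    proof (intro equalityI subsetI)
      fix z assume "z \<in> carrier K \<times> carrier F"
      then obtain a x where z: "z = (a, x)" "a \<in> carrier K" "x \<in> carrier F" by blast
      let ?q = "i a \<otimes> sect x"
      have q: "?q \<in> carrier Q" "p ?q = x" using z by auto
      then have "d ?q = a" using z by (intro d_eqI) auto
      then have "z = (d ?q, p ?q)" using z(1) q(2) by simp
      then show "z \<in> (\<lambda>q. (d q, p q)) ` carrier Q" using q(1) by (rule image_eqI)
    qed (auto simp: d_closed)
    ultimately show "bij_betw (\<lambda>q. (d q, p q)) (carrier Q) (carrier ?P)"
      by (simp add: bij_betw_def twisted_semidirect_def)
  qed
  then show ?thesis by (auto simp: is_iso_def)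
qed

end

section \<open>Twisted semidirect products\<close>

locale twisted_product = K: comm_group K + F: loop F
  for K (structure) and F (structure) +
  fixes \<theta> \<phi>
  assumes cocycle: "loop_cocycle F K \<theta>"
    and action: "\<phi> \<in> hom F (AutoGroup K)"
begin

abbreviation P where "P \<equiv> twisted_semidirect K F \<theta> \<phi>"

lemma carrier_P [simp]: "carrier P = carrier K \<times> carrier F"
  by (simp add: twisted_semidirect_def)

lemma mult_P [simp]:
  "(a, x) \<otimes>\<^bsub>P\<^esub> (b, y) = (a \<otimes>\<^bsub>K\<^esub> \<phi> x b \<otimes>\<^bsub>K\<^esub> \<theta> (x, y), x \<otimes>\<^bsub>F\<^esub> y)"
  by (simp add: twisted_semidirect_def)

lemma \<theta>_closed [simp]: "x \<in> carrier F \<Longrightarrow> y \<in> carrier F \<Longrightarrow> \<theta> (x, y) \<in> carrier K"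
  and \<theta>_one [simp]: "x \<in> carrier F \<Longrightarrow> \<theta> (x, \<one>\<^bsub>F\<^esub>) = \<one>\<^bsub>K\<^esub>" "x \<in> carrier F \<Longrightarrow> \<theta> (\<one>\<^bsub>F\<^esub>, x) = \<one>\<^bsub>K\<^esub>"
  using cocycle by (auto simp: loop_cocycle_def)

lemma \<phi>_auto: "x \<in> carrier F \<Longrightarrow> \<phi> x \<in> auto K"
  using action by (auto simp: hom_def AutoGroup_def)

lemma \<phi>_hom: "x \<in> carrier F \<Longrightarrow> \<phi> x \<in> hom K K"
  using \<phi>_auto by (auto simp: auto_def)

lemma \<phi>_closed [simp]: "x \<in> carrier F \<Longrightarrow> a \<in> carrier K \<Longrightarrow> \<phi> x a \<in> carrier K"
  using \<phi>_hom by (auto simp: hom_def)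

lemma \<phi>_mult [simp]:
  "x \<in> carrier F \<Longrightarrow> a \<in> carrier K \<Longrightarrow> b \<in> carrier K \<Longrightarrow> \<phi> x (a \<otimes>\<^bsub>K\<^esub> b) = \<phi> x a \<otimes>\<^bsub>K\<^esub> \<phi> x b"
  using \<phi>_hom by (auto simp: hom_def)

lemma \<phi>_comp [simp]:
  assumes "x \<in> carrier F" "y \<in> carrier F" "a \<in> carrier K"
  shows "\<phi> (x \<otimes>\<^bsub>F\<^esub> y) a = \<phi> x (\<phi> y a)"
proof -
  have "\<phi> (x \<otimes>\<^bsub>F\<^esub> y) = \<phi> x \<otimes>\<^bsub>AutoGroup K\<^esub> \<phi> y"
    using action assms by (auto simp: hom_def)
  then show ?thesis
    using assms \<phi>_auto[of x] \<phi>_auto[of y]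
    by (simp add: AutoGroup_def BijGroup_def auto_def compose_def)
qed

text \<open>Since \<open>F\<close> need not be a group, the facts on group homomorphisms do not apply; instead,
  \<open>\<phi> \<one>\<close> is the identity because it is idempotent and injective.\<close>

lemma \<phi>_one [simp]:
  assumes "a \<in> carrier K"
  shows "\<phi> \<one>\<^bsub>F\<^esub> a = a"
proof -
  have "inj_on (\<phi> \<one>\<^bsub>F\<^esub>) (carrier K)"
    using \<phi>_auto[of "\<one>\<^bsub>F\<^esub>"] by (simp add: auto_def Bij_def bij_betw_def)
  moreover have "\<phi> \<one>\<^bsub>F\<^esub> (\<phi> \<one>\<^bsub>F\<^esub> a) = \<phi> \<one>\<^bsub>F\<^esub> a"
    using \<phi>_comp[of "\<one>\<^bsub>F\<^esub>" "\<one>\<^bsub>F\<^esub>" a] assms by simp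
  ultimately show ?thesis using assms by (simp add: inj_on_eq_iff)
qed

text \<open>The homomorphism law of \<open>\<phi>\<close> handles \<open>s\<close> in the third position; commutativity of \<open>K\<close> is what
  moves the factor coming from \<open>s\<close> past the value of \<open>\<theta>\<close>.\<close>

lemma twisted_semidirect_nuclear:
  assumes a: "a \<in> carrier K" and "u \<in> carrier P" "v \<in> carrier P"
  defines "s \<equiv> (a, \<one>\<^bsub>F\<^esub>)"
  shows "(s \<otimes>\<^bsub>P\<^esub> u) \<otimes>\<^bsub>P\<^esub> v = s \<otimes>\<^bsub>P\<^esub> (u \<otimes>\<^bsub>P\<^esub> v)"
    "(u \<otimes>\<^bsub>P\<^esub> s) \<otimes>\<^bsub>P\<^esub> v = u \<otimes>\<^bsub>P\<^esub> (s \<otimes>\<^bsub>P\<^esub> v)"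
    "(u \<otimes>\<^bsub>P\<^esub> v) \<otimes>\<^bsub>P\<^esub> s = u \<otimes>\<^bsub>P\<^esub> (v \<otimes>\<^bsub>P\<^esub> s)"
proof -
  obtain b x where u: "u = (b, x)" "b \<in> carrier K" "x \<in> carrier F" using assms by auto
  obtain c y where v: "v = (c, y)" "c \<in> carrier K" "y \<in> carrier F" using assms by auto
  show "(s \<otimes>\<^bsub>P\<^esub> u) \<otimes>\<^bsub>P\<^esub> v = s \<otimes>\<^bsub>P\<^esub> (u \<otimes>\<^bsub>P\<^esub> v)"
    "(u \<otimes>\<^bsub>P\<^esub> s) \<otimes>\<^bsub>P\<^esub> v = u \<otimes>\<^bsub>P\<^esub> (s \<otimes>\<^bsub>P\<^esub> v)"
    "(u \<otimes>\<^bsub>P\<^esub> v) \<otimes>\<^bsub>P\<^esub> s = u \<otimes>\<^bsub>P\<^esub> (v \<otimes>\<^bsub>P\<^esub> s)"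
    using a u v unfolding s_def by (simp_all add: K.m_ac)
qed

text \<open>The loop structure of \<open>Q\<close> makes associativity in the product transfer to \<open>Q\<close> through an
  isomorphism, and the kernel of the second coordinate is then a nuclear copy of \<open>K\<close>.\<close>

lemma extension_of_iso:
  assumes "loop Q" and h: "h \<in> iso Q P"
  shows "\<exists>S. normal_subloop S Q \<and> Q\<lparr>carrier := S\<rparr> \<cong> K \<and> Q Mod S \<cong> F \<and> S \<subseteq> nucleus Q"
proof -
  interpret Q: loop Q by fact
  have h_closed: "h q \<in> carrier K \<times> carrier F" if "q \<in> carrier Q" for q
    using h that by (auto simp: iso_def hom_def)
  have h_mult: "h (q \<otimes>\<^bsub>Q\<^esub> r) = h q \<otimes>\<^bsub>P\<^esub> h r" if "q \<in> carrier Q" "r \<in> carrier Q" for q r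
    using h that by (auto simp: iso_def hom_def)
  have h_bij: "bij_betw h (carrier Q) (carrier K \<times> carrier F)"
    using h by (simp add: iso_def)
  have h_inj: "h q = h r \<longleftrightarrow> q = r" if "q \<in> carrier Q" "r \<in> carrier Q" for q r
    using h_bij that by (auto simp: bij_betw_def inj_on_eq_iff)
  have h_surj: "\<exists>q \<in> carrier Q. h q = (a, x)" if "a \<in> carrier K" "x \<in> carrier F" for a x
  proof -
    have "(a, x) \<in> h ` carrier Q" using h_bij that by (simp add: bij_betw_def)
    then show ?thesis by force
  qed
  define p where "p q = snd (h q)" for q
  have snd_mult: "snd (u \<otimes>\<^bsub>P\<^esub> v) = snd u \<otimes>\<^bsub>F\<^esub> snd v" for u v
    by (cases u; cases v) simp
  interpret loop_hom Q F p
  proof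
    show "p \<in> hom Q F"
      by (rule homI) (use h_closed in \<open>auto simp: p_def h_mult snd_mult mem_Times_iff\<close>)
  qed
  let ?S = "kernel Q F p"
  have h_S: "\<exists>a \<in> carrier K. h s = (a, \<one>\<^bsub>F\<^esub>)" if "s \<in> ?S" for s
    using that h_closed[of s] by (cases "h s") (auto simp: kernel_iff p_def)
  have S_closed: "s \<in> carrier Q" if "s \<in> ?S" for s
    using that by (simp add: kernel_iff)
  have p_surj: "p ` carrier Q = carrier F"
  proof (intro equalityI subsetI)
    fix x assume "x \<in> carrier F"
    then obtain q where "q \<in> carrier Q" "h q = (\<one>\<^bsub>K\<^esub>, x)" using h_surj by blast
    then show "x \<in> p ` carrier Q" by (force simp: p_def)
  qed auto
  have "?S \<subseteq> nucleus Q"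
  proof
    fix s assume s: "s \<in> ?S"
    then obtain a where a: "a \<in> carrier K" "h s = (a, \<one>\<^bsub>F\<^esub>)" using h_S by blast
    have "s \<otimes>\<^bsub>Q\<^esub> u \<otimes>\<^bsub>Q\<^esub> v = s \<otimes>\<^bsub>Q\<^esub> (u \<otimes>\<^bsub>Q\<^esub> v) \<and> u \<otimes>\<^bsub>Q\<^esub> s \<otimes>\<^bsub>Q\<^esub> v = u \<otimes>\<^bsub>Q\<^esub> (s \<otimes>\<^bsub>Q\<^esub> v) \<and>
        u \<otimes>\<^bsub>Q\<^esub> v \<otimes>\<^bsub>Q\<^esub> s = u \<otimes>\<^bsub>Q\<^esub> (v \<otimes>\<^bsub>Q\<^esub> s)"
      if u: "u \<in> carrier Q" and v: "v \<in> carrier Q" for u v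
    proof -
      have "h u \<in> carrier P" "h v \<in> carrier P" using h_closed u v by auto
      note nuc = twisted_semidirect_nuclear[OF a(1) this]
      have "h (s \<otimes>\<^bsub>Q\<^esub> u \<otimes>\<^bsub>Q\<^esub> v) = h (s \<otimes>\<^bsub>Q\<^esub> (u \<otimes>\<^bsub>Q\<^esub> v))"
        "h (u \<otimes>\<^bsub>Q\<^esub> s \<otimes>\<^bsub>Q\<^esub> v) = h (u \<otimes>\<^bsub>Q\<^esub> (s \<otimes>\<^bsub>Q\<^esub> v))"
        "h (u \<otimes>\<^bsub>Q\<^esub> v \<otimes>\<^bsub>Q\<^esub> s) = h (u \<otimes>\<^bsub>Q\<^esub> (v \<otimes>\<^bsub>Q\<^esub> s))"
        using u v S_closed[OF s] nuc by (simp_all add: h_mult a(2))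
      then show ?thesis using u v S_closed[OF s] by (simp add: h_inj)
    qed
    then show "s \<in> nucleus Q" using S_closed[OF s] by (simp add: Q.nucleus_iff)
  qed
  moreover have "(\<lambda>s. fst (h s)) \<in> iso (Q\<lparr>carrier := ?S\<rparr>) K"
  proof (rule isoI)
    show "(\<lambda>s. fst (h s)) \<in> hom (Q\<lparr>carrier := ?S\<rparr>) K"
    proof (rule homI)
      fix s r assume "s \<in> carrier (Q\<lparr>carrier := ?S\<rparr>)" "r \<in> carrier (Q\<lparr>carrier := ?S\<rparr>)"
      then have s: "s \<in> ?S" and r: "r \<in> ?S" by auto
      obtain a b where "a \<in> carrier K" "h s = (a, \<one>\<^bsub>F\<^esub>)" "b \<in> carrier K" "h r = (b, \<one>\<^bsub>F\<^esub>)"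
        using h_S s r by blast
      then show "fst (h (s \<otimes>\<^bsub>Q\<lparr>carrier := ?S\<rparr>\<^esub> r)) = fst (h s) \<otimes>\<^bsub>K\<^esub> fst (h r)"
        using s r by (simp add: h_mult S_closed)
    qed (use h_S in force)
    have "inj_on (\<lambda>s. fst (h s)) ?S"
    proof (rule inj_onI)
      fix s r assume s: "s \<in> ?S" and r: "r \<in> ?S" and "fst (h s) = fst (h r)"
      then have "h s = h r" using h_S[OF s] h_S[OF r] by auto
      then show "s = r" using s r by (simp add: h_inj S_closed)
    qed
    moreover have "(\<lambda>s. fst (h s)) ` ?S = carrier K"
    proof (intro equalityI subsetI)
      fix a assume "a \<in> carrier K"
      then obtain q where "q \<in> carrier Q" "h q = (a, \<one>\<^bsub>F\<^esub>)" using h_surj by blast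
      then show "a \<in> (\<lambda>s. fst (h s)) ` ?S" by (force simp: kernel_iff p_def)
    qed (use h_S in force)
    ultimately show "bij_betw (\<lambda>s. fst (h s)) (carrier (Q\<lparr>carrier := ?S\<rparr>)) (carrier K)"
      by (simp add: bij_betw_def)
  qed
  ultimately show ?thesis
    using normal_subloop_kernel kernel_Mod_iso[OF p_surj] by (auto simp: is_iso_def)
qed

end

section \<open>The equivalence\<close>

text \<open>As the isomorphism \<open>\<beta>\<close> is injective and sends the coset of \<open>\<one>\<close> to \<open>\<one>\<close>, composing it with
  the coset map does not enlarge the kernel beyond \<open>S\<close>.\<close>

lemma nuclear_extension_of_normal:
  assumes K: "comm_group K" and Q: "loop Q" and F: "loop F"
    and S: "normal_subloop S Q" "S \<subseteq> nucleus Q"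
    and k: "k \<in> iso (Q\<lparr>carrier := S\<rparr>) K" and \<beta>: "\<beta> \<in> iso (Q Mod S) F"
  shows "nuclear_extension Q F (\<lambda>q. \<beta> (S #>\<^bsub>Q\<^esub> q)) K (inv_into S k)"
proof -
  interpret Q: loop Q by fact
  interpret F: loop F by fact
  interpret K: comm_group K by fact
  interpret S: loop "Q\<lparr>carrier := S\<rparr>" using S by (simp add: normal_subloop_def subloop_def)
  let ?p = "\<lambda>q. \<beta> (S #>\<^bsub>Q\<^esub> q)"
  have sub: "S \<subseteq> carrier Q" using S by (simp add: normal_subloop_def subloop_def)
  have carr: "carrier (Q Mod S) = (\<lambda>x. S #>\<^bsub>Q\<^esub> x) ` carrier Q"
    by (rule carrier_FactGroup)
  have "\<beta> \<in> hom (Q Mod S) F" using \<beta> by (simp add: iso_def)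
  then have "?p \<in> hom Q F"
    using hom_compose[OF normal_subloop_rcos_hom[OF Q S(1)]] by (simp add: comp_def)
  then interpret loop_hom Q F ?p by unfold_locales
  have \<beta>_bij: "inj_on \<beta> (carrier (Q Mod S))" "\<beta> ` carrier (Q Mod S) = carrier F"
    using \<beta> by (auto simp: iso_def bij_betw_def)
  have ker: "kernel Q F ?p = S"
  proof -
    have "?p q = \<one>\<^bsub>F\<^esub> \<longleftrightarrow> q \<in> S" if q: "q \<in> carrier Q" for q
    proof -
      have "?p q = \<one>\<^bsub>F\<^esub> \<longleftrightarrow> ?p q = ?p \<one>\<^bsub>Q\<^esub>" by (subst hom_one) simp
      also have "\<dots> \<longleftrightarrow> S #>\<^bsub>Q\<^esub> q = S #>\<^bsub>Q\<^esub> \<one>\<^bsub>Q\<^esub>"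
        using q by (intro inj_on_eq_iff[OF \<beta>_bij(1)]) (auto simp: carr)
      finally show ?thesis using normal_subloop_rcos_eq_iff[OF Q S(1) q] by simp
    qed
    then show ?thesis using sub by (auto simp: kernel_def)
  qed
  have k_bij: "bij_betw k S (carrier K)" using k by (simp add: iso_def)
  have k_mult: "k (s \<otimes>\<^bsub>Q\<^esub> r) = k s \<otimes>\<^bsub>K\<^esub> k r" if "s \<in> S" "r \<in> S" for s r
    using k that by (auto simp: iso_def hom_def)
  have i_bij: "bij_betw (inv_into S k) (carrier K) S"
    using k_bij by (rule bij_betw_inv_into)
  have i_S: "inv_into S k a \<in> S" if "a \<in> carrier K" for a
    using i_bij that by (auto simp: bij_betw_def)
  have k_i: "k (inv_into S k a) = a" if "a \<in> carrier K" for a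
    using k_bij that by (simp add: bij_betw_inv_into_right)
  show ?thesis
  proof
    show "inv_into S k \<in> hom K Q"
    proof (rule homI)
      fix a b assume a: "a \<in> carrier K" and b: "b \<in> carrier K"
      have "inv_into S k a \<otimes>\<^bsub>Q\<^esub> inv_into S k b \<in> S"
        using S.m_closed i_S a b by simp
      then show "inv_into S k (a \<otimes>\<^bsub>K\<^esub> b) = inv_into S k a \<otimes>\<^bsub>Q\<^esub> inv_into S k b"
        using a b k_bij
        by (intro inv_into_f_eq) (auto simp: bij_betw_def k_mult i_S k_i)
    qed (use i_S sub in auto)
    show "?p ` carrier Q = carrier F"
      using \<beta>_bij(2) by (simp add: carr image_image)
  qed (use i_bij S in \<open>auto simp: bij_betw_def ker\<close>)
qed

theorem theorem2p2:
  fixes K :: "'k monoid" and Q :: "'q monoid" and F :: "'f monoid"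
  assumes "comm_group K" and "loop Q" and "loop F"
  shows "(\<exists>S. normal_subloop S Q \<and> Q\<lparr>carrier := S\<rparr> \<cong> K \<and> Q Mod S \<cong> F \<and> S \<subseteq> nucleus Q)
    \<longleftrightarrow> (\<exists>\<theta> \<phi>. loop_cocycle F K \<theta> \<and> \<phi> \<in> hom F (AutoGroup K) \<and>
          Q \<cong> twisted_semidirect K F \<theta> \<phi>)"
proof
  assume "\<exists>S. normal_subloop S Q \<and> Q\<lparr>carrier := S\<rparr> \<cong> K \<and> Q Mod S \<cong> F \<and> S \<subseteq> nucleus Q"
  then obtain S k \<beta> where "normal_subloop S Q" "S \<subseteq> nucleus Q"
    "k \<in> iso (Q\<lparr>carrier := S\<rparr>) K" "\<beta> \<in> iso (Q Mod S) F"
    by (auto simp: is_iso_def)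
  then interpret nuclear_extension Q F "\<lambda>q. \<beta> (S #>\<^bsub>Q\<^esub> q)" K "inv_into S k"
    by (intro nuclear_extension_of_normal assms)
  show "\<exists>\<theta> \<phi>. loop_cocycle F K \<theta> \<and> \<phi> \<in> hom F (AutoGroup K) \<and> Q \<cong> twisted_semidirect K F \<theta> \<phi>"
    using loop_cocycle act_sect_hom iso_twisted_semidirect by blast
next
  assume "\<exists>\<theta> \<phi>. loop_cocycle F K \<theta> \<and> \<phi> \<in> hom F (AutoGroup K) \<and> Q \<cong> twisted_semidirect K F \<theta> \<phi>"
  then obtain \<theta> \<phi> h where "loop_cocycle F K \<theta>" "\<phi> \<in> hom F (AutoGroup K)"
    and h: "h \<in> iso Q (twisted_semidirect K F \<theta> \<phi>)"
    by (auto simp: is_iso_def)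
  then interpret twisted_product K F \<theta> \<phi>
    using assms by (simp add: twisted_product_def twisted_product_axioms_def)
  show "\<exists>S. normal_subloop S Q \<and> Q\<lparr>carrier := S\<rparr> \<cong> K \<and> Q Mod S \<cong> F \<and> S \<subseteq> nucleus Q"
    using extension_of_iso[OF assms(2) h] .
qed

end
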